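(* Let $T$ be a linear operator on the space of functions from $\mathbb{R}_+$ to $\mathbb{R}$ that commutes with $\Delta$, that is, $T\Delta=\Delta T$, and let $m,p\in\mathbb{N}$. Suppose that a function $f\in\mathrm{dom}\,\Sigma^{m+1}$ satisfies $$Tf\in\mathcal{D}^p\cap\mathcal{K}^{p+m}\quad\text{and}\quad T\Sigma^{m+1}f\in\mathcal{K}^{p+2m}.$$ Then $$\Sigma^{m+1}Tf(x)=\rho_1^{m+1}[T\Sigma^{m+1}f](x-1)\qquad(x>0).$$
   Context: $\mathbb{N}$ is the set of nonnegative integers, $\mathbb{R}_+=(0,\infty)$, $\Delta f(x)=f(x+1)-f(x)$, and $\binom{x}{j}=x(x-1)\cdots(x-j+1)/j!$ for real $x$ and $j\in\mathbb{N}$. For $a>0$, $p\in\mathbb{N}$ and $f\colon\mathbb{R}_+\to\mathbb{R}$, the function $\rho_a^p[f]\colon(-a,\infty)\to\mathbb{R}$ is defined by $\rho_a^p[f](x)=f(x+a)-\sum_{j=0}^{p-1}\binom{x}{j}\Delta^jf(a)$. For an integer $p\ge -1$, a function $f$ on a real interval $I$ is $p$-convex if its divided difference $f[x_0,\dots,x_{p+1}]$ is $\ge 0$ at any $p+2$ pairwise distinct points of $I$, and $p$-concave if $-f$ is $p$-convex. For $p\in\mathbb{N}$, $\mathcal{D}^p$ is the set of functions $f\colon\mathbb{R}_+\to\mathbb{R}$ such that $\Delta^pf(n)\to0$ as the integer $n\to\infty$. For an integer $p\ge-1$, $\mathcal{K}^p$ is the set of functions $f\colon\mathbb{R}_+\to\mathbb{R}$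 that are eventually $p$-convex or eventually $p$-concave (i.e. $p$-convex, or $p$-concave, on some half-line $(M,\infty)$). Definition of $\Sigma$ (known well-definedness): $\mathrm{dom}\,\Sigma=\bigcup_{p\ge0}(\mathcal{D}^p\cap\mathcal{K}^p)$. If $g\in\mathcal{D}^p\cap\mathcal{K}^p$, then $\Sigma g\colon\mathbb{R}_+\to\mathbb{R}$ is the unique solution $f\in\mathcal{K}^p$ of $\Delta f=g$ on $\mathbb{R}_+$ with $f(1)=0$; it is given by the pointwise limit $$\Sigma g(x)=\lim_{n\to\infty}\Big(\sum_{k=1}^{n-1}g(k)-\sum_{k=0}^{n-1}g(x+k)+\sum_{j=1}^p\binom{x}{j}\Delta^{j-1}g(n)\Big),$$ and it does not depend on the choice of $p$. Iterates: $\Sigma^0=\mathrm{id}$, $\Sigma^{m+1}=\Sigma\circ\Sigma^m$; $g\in\mathrm{dom}\,\Sigma^{m+1}$ means $g\in\mathrm{dom}\,\Sigma^m$ and $\Sigma^mg\in\mathrm{dom}\,\Sigma$. It is known that $\mathcal{D}^p\cap\mathcal{K}^{p+m}\subset\mathrm{dom}\,\Sigma^{m+1}$. $\Sigma^{m+1}Tf$ denotes $\Sigma^{m+1}$ applied to $Tf$. *)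

theory Defs
  imports Complex_Main "HOL-Library.FuncSet"
begin

text \<open>
  A function from the positive half-line to the reals is represented by a function of type
  \<^typ>\<open>real \<Rightarrow> real\<close> whose values outside \<open>{0<..}\<close> are irrelevant.
\<close>

definition fdiff :: "(real \<Rightarrow> real) \<Rightarrow> real \<Rightarrow> real" where
  "fdiff f = (\<lambda>x. f (x + 1) - f x)"

definition rho :: "real \<Rightarrow> nat \<Rightarrow> (real \<Rightarrow> real) \<Rightarrow> real \<Rightarrow> real" where
  "rho a p f x = f (x + a) - (\<Sum>j<p. (x gchoose j) * (fdiff ^^ j) f a)"

text \<open>The divided difference \<open>f[x\<^sub>0,\<dots>,x\<^sub>n]\<close>, with the points given as a list; the value for
  the empty list is a dummy.\<close>

function divided_diff :: "(real \<Rightarrow> real) \<Rightarrow> real list \<Rightarrow> real" where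
  "divided_diff f [] = 0"
| "divided_diff f [x] = f x"
| "divided_diff f (x # y # xs) =
     (divided_diff f (y # xs) - divided_diff f (butlast (x # y # xs))) / (last (y # xs) - x)"
  by pat_completeness auto
termination by (relation "measure (\<lambda>(f, xs). length xs)") auto

text \<open>The order is an integer so that \<open>p = -1\<close> (nonnegative functions) is included.\<close>

definition p_convex_on :: "int \<Rightarrow> real set \<Rightarrow> (real \<Rightarrow> real) \<Rightarrow> bool" where
  "p_convex_on p I f \<longleftrightarrow>
     (\<forall>xs. int (length xs) = p + 2 \<and> distinct xs \<and> set xs \<subseteq> I \<longrightarrow> divided_diff f xs \<ge> 0)"

definition p_concave_on :: "int \<Rightarrow> real set \<Rightarrow> (real \<Rightarrow> real) \<Rightarrow> bool" where
  "p_concave_on p I f \<longleftrightarrow> p_convex_on p I (\<lambda>x. - f x)"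

definition D_class :: "nat \<Rightarrow> (real \<Rightarrow> real) set" where
  "D_class p = {f. (\<lambda>n::nat. (fdiff ^^ p) f (real n)) \<longlonglongrightarrow> 0}"

definition K_class :: "int \<Rightarrow> (real \<Rightarrow> real) set" where
  "K_class p = {f. \<exists>M\<ge>0. p_convex_on p {M<..} f \<or> p_concave_on p {M<..} f}"

definition dom_Sum :: "(real \<Rightarrow> real) set" where
  "dom_Sum = (\<Union>p::nat. D_class p \<inter> K_class (int p))"

text \<open>The operator \<open>\<Sigma>\<close>. The solution is unique only as a function on \<open>{0<..}\<close>, so outside of this
  set its values are fixed by extensionality; it does not depend on the choice of \<open>p\<close>.\<close>

definition Sum_op :: "(real \<Rightarrow> real) \<Rightarrow> real \<Rightarrow> real" where
  "Sum_op g = (THE f. f \<in> extensional {0<..} \<and>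
     (\<exists>p::nat. g \<in> D_class p \<inter> K_class (int p) \<and> f \<in> K_class (int p)) \<and>
     (\<forall>x>0. fdiff f x = g x) \<and> f 1 = 0)"

primrec dom_Sum_iter :: "nat \<Rightarrow> (real \<Rightarrow> real) set" where
  "dom_Sum_iter 0 = UNIV"
| "dom_Sum_iter (Suc m) = {g \<in> dom_Sum_iter m. (Sum_op ^^ m) g \<in> dom_Sum}"

text \<open>Linear operators on the space of functions from \<open>{0<..}\<close> to the reals. The first condition
  says that \<open>T\<close> is well defined on that space, i.e. the values of \<open>T f\<close> on \<open>{0<..}\<close> depend only on
  the values of \<open>f\<close> on \<open>{0<..}\<close>.\<close>

definition linear_operator :: "((real \<Rightarrow> real) \<Rightarrow> real \<Rightarrow> real) \<Rightarrow> bool" where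
  "linear_operator T \<longleftrightarrow>
     (\<forall>f g. (\<forall>x>0. f x = g x) \<longrightarrow> (\<forall>x>0. T f x = T g x)) \<and>
     (\<forall>f g. \<forall>x>0. T (\<lambda>t. f t + g t) x = T f x + T g x) \<and>
     (\<forall>c f. \<forall>x>0. T (\<lambda>t. c * f t) x = c * T f x)"

end

theory Submission
  imports Defs
begin

text \<open>
  Put \<open>F = \<Sigma>\<^sup>m\<^sup>+\<^sup>1 f\<close> and let \<open>H\<close> be the right-hand side of the claim. Newton's formula subtracts
  from \<open>T F\<close> the polynomial of degree at most \<open>m\<close> that agrees with it at \<open>1, \<dots>, m + 1\<close>; hence
  \<open>\<Delta>\<^sup>i H\<close> vanishes at \<open>1\<close> for \<open>i \<le> m\<close>, while \<open>\<Delta>\<^sup>m\<^sup>+\<^sup>1 H = \<Delta>\<^sup>m\<^sup>+\<^sup>1 T F = T \<Delta>\<^sup>m\<^sup>+\<^sup>1 F = T f\<close>. So each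
  \<open>\<Delta>\<^sup>i H\<close> with \<open>i \<le> m\<close> solves the difference equation that \<open>\<Sigma>\<close> solves for \<open>\<Delta>\<^sup>i\<^sup>+\<^sup>1 H\<close>, with the right
  initial value, and the claim is that it is the solution selected by \<open>\<Sigma>\<close>, down to \<open>i = 0\<close>.

  This selection is made by convexity. Polynomials of degree at most \<open>m\<close> do not change
  \<open>(p + 2m)\<close>-convexity, each difference \<open>\<Delta>\<close> lowers the order of convexity by one
  (\<open>K_class_fdiff\<close>), and an eventually \<open>(q + 1)\<close>-convex function is eventually \<open>q\<close>-convex or
  \<open>q\<close>-concave (\<open>K_class_Suc_subset\<close>). Therefore all \<open>\<Delta>\<^sup>i H\<close> with \<open>i \<le> m\<close> lie in the class of the one
  order \<open>q = p + m\<close>, and \<open>\<Delta>\<^sup>q \<Delta>\<^sup>i H (n) \<longlonglongrightarrow> 0\<close> for \<open>1 \<le> i \<le> m + 1\<close>; the order \<open>q\<close> serves in all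
  \<open>m + 1\<close> steps.

  What remains is the theory of a single \<open>\<Sigma>\<close>: uniqueness of the solution, which identifies
  \<open>\<Sigma>\<close>, and existence, without which \<open>\<Delta>\<^sup>m\<^sup>+\<^sup>1 F = f\<close> would not be known. Both rest on
  \<open>rho_bound\<close>: the error of Newton interpolation of a \<open>p\<close>-convex function on \<open>p + 1\<close> consecutive
  points is controlled by the increment of \<open>\<Delta>\<^sup>p f\<close> over a bounded number of steps. If
  \<open>\<Delta>\<^sup>p\<^sup>+\<^sup>1 f (n) \<longlonglongrightarrow> 0\<close> the error vanishes as the points move to infinity, whereas the
  error of a periodic function vanishing at \<open>1\<close> is the function itself: this gives uniqueness. If
  \<open>\<Delta>\<^sup>p g (n) \<longlonglongrightarrow> 0\<close> the increments telescope, so the errors are summable, and they make up the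
  steps of the sequence that converges to the solution: this gives existence.
\<close>

section \<open>Divided differences over finite sets\<close>

text \<open>This is Lagrange's closed form of the divided difference. Its value depends only on
  the set of points, so symmetry in the points, which the recursion hides, is built in.\<close>

definition ddiff :: "(real \<Rightarrow> real) \<Rightarrow> real set \<Rightarrow> real" where
  "ddiff f S = (\<Sum>x\<in>S. f x / (\<Prod>y\<in>S - {x}. x - y))"

lemma ddiff_cong: "(\<And>x. x \<in> S \<Longrightarrow> f x = g x) \<Longrightarrow> ddiff f S = ddiff g S"
  by (simp add: ddiff_def)

lemma ddiff_add: "ddiff (\<lambda>x. f x + g x) S = ddiff f S + ddiff g S"
  by (simp add: ddiff_def add_divide_distrib sum.distrib)

lemma ddiff_cmult: "ddiff (\<lambda>x. c * f x) S = c * ddiff f S"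
  by (simp add: ddiff_def sum_distrib_left)

lemma ddiff_minus: "ddiff (\<lambda>x. - f x) S = - ddiff f S"
  using ddiff_cmult[of "-1" f S] by simp

lemma ddiff_diff: "ddiff (\<lambda>x. f x - g x) S = ddiff f S - ddiff g S"
  using ddiff_add[of f "\<lambda>x. - g x" S] by (simp add: ddiff_minus)

lemma ddiff_sum: "ddiff (\<lambda>x. \<Sum>i\<in>A. f i x) S = (\<Sum>i\<in>A. ddiff (f i) S)"
  unfolding ddiff_def by (subst sum.swap) (simp add: sum_divide_distrib)

lemma ddiff_shift: "ddiff (\<lambda>x. f (x + c)) S = ddiff f ((\<lambda>x. x + c) ` S)"
proof -
  have "(\<Prod>y\<in>(\<lambda>x. x + c) ` S - {x + c}. x + c - y) = (\<Prod>y\<in>S - {x}. x - y)" for x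
  proof -
    have "(\<lambda>x. x + c) ` S - {x + c} = (\<lambda>x. x + c) ` (S - {x})"
      by auto
    then show ?thesis
      by (simp add: prod.reindex)
  qed
  then show ?thesis
    by (simp add: ddiff_def sum.reindex)
qed

text \<open>The factor \<open>x - a\<close> kills the term of the point \<open>a\<close> and cancels the factor of \<open>a\<close> in
  the denominators of all other terms.\<close>

lemma ddiff_mult_node:
  assumes "finite S" "a \<in> S"
  shows "ddiff (\<lambda>x. (x - a) * f x) S = ddiff f (S - {a})"
proof -
  have "(x - a) * f x / (\<Prod>y\<in>S - {x}. x - y) = f x / (\<Prod>y\<in>S - {a} - {x}. x - y)"
    if x: "x \<in> S - {a}" for x
  proof -
    have "S - {x} = insert a (S - {a} - {x})"
      using x assms by auto
    then have "(\<Prod>y\<in>S - {x}. x - y) = (x - a) * (\<Prod>y\<in>S - {a} - {x}. x - y)"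
      using assms by simp
    then show ?thesis
      using x by simp
  qed
  then have "(\<Sum>x\<in>S - {a}. (x - a) * f x / (\<Prod>y\<in>S - {x}. x - y)) = ddiff f (S - {a})"
    by (simp add: ddiff_def)
  then show ?thesis
    using assms by (simp add: ddiff_def sum.remove)
qed

text \<open>Since \<open>b - a = (x - a) - (x - b)\<close>, this is a difference of two instances of
  \<open>ddiff_mult_node\<close>.\<close>

lemma ddiff_recursion:
  assumes "finite S" "a \<in> S" "b \<in> S"
  shows "(b - a) * ddiff f S = ddiff f (S - {a}) - ddiff f (S - {b})"
proof -
  have "(b - a) * ddiff f S = ddiff (\<lambda>x. (x - a) * f x - (x - b) * f x) S"
    by (subst ddiff_cmult[symmetric]) (simp add: algebra_simps)
  then show ?thesis
    using assms by (simp add: ddiff_diff ddiff_mult_node)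
qed

lemma ddiff_replace_node:
  assumes "finite C" "a \<notin> C" "b \<notin> C" "a \<noteq> b"
  shows "ddiff f (insert b C) - ddiff f (insert a C) = (b - a) * ddiff f (insert a (insert b C))"
proof -
  have "insert a (insert b C) - {a} = insert b C" "insert a (insert b C) - {b} = insert a C"
    using assms by auto
  then show ?thesis
    using ddiff_recursion[of "insert a (insert b C)" a b f] assms by simp
qed

lemma divided_diff_eq_ddiff: "distinct xs \<Longrightarrow> divided_diff f xs = ddiff f (set xs)"
proof (induction f xs rule: divided_diff.induct)
  case (3 f x y xs)
  let ?l = "x # y # xs"
  have "last (y # xs) \<in> set (y # xs)"
    by (rule last_in_set) simp
  then have ne: "last (y # xs) \<noteq> x"
    using 3(3) by auto
  have "set (butlast l) = set l - {last l}" if "distinct l" "l \<noteq> []" for l :: "real list"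
    using that by (cases l rule: rev_cases) auto
  from this[of ?l] have bl: "set (butlast ?l) = set ?l - {last (y # xs)}"
    using 3(3) by simp
  have tl: "set (y # xs) = set ?l - {x}"
    using 3(3) by auto
  have "(last (y # xs) - x) * ddiff f (set ?l) = ddiff f (set (y # xs)) - ddiff f (set (butlast ?l))"
    unfolding bl tl by (rule ddiff_recursion) (use \<open>last (y # xs) \<in> set (y # xs)\<close> in auto)
  moreover have "divided_diff f (y # xs) = ddiff f (set (y # xs))"
    by (rule 3(1)) (use 3(3) in simp)
  moreover have "divided_diff f (butlast ?l) = ddiff f (set (butlast ?l))"
    by (rule 3(2)) (rule distinct_butlast[OF 3(3)])
  ultimately have "divided_diff f ?l =
      (last (y # xs) - x) * ddiff f (set ?l) / (last (y # xs) - x)"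
    by (simp only: divided_diff.simps)
  then show ?case
    using ne by (simp only: nonzero_mult_div_cancel_left right_minus_eq not_False_eq_True)
qed (simp_all add: ddiff_def)

lemma p_convex_on_iff_ddiff:
  "p_convex_on (int p) I f \<longleftrightarrow> (\<forall>S. finite S \<and> card S = p + 2 \<and> S \<subseteq> I \<longrightarrow> 0 \<le> ddiff f S)"
proof
  assume c: "p_convex_on (int p) I f"
  show "\<forall>S. finite S \<and> card S = p + 2 \<and> S \<subseteq> I \<longrightarrow> 0 \<le> ddiff f S"
  proof (intro allI impI)
    fix S :: "real set"
    assume S: "finite S \<and> card S = p + 2 \<and> S \<subseteq> I"
    then obtain xs where xs: "set xs = S" "distinct xs"
      using finite_distinct_list by blast
    then have "int (length xs) = int p + 2"
      using S distinct_card[of xs] by simp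
    then have "0 \<le> divided_diff f xs"
      using c S xs unfolding p_convex_on_def by blast
    then show "0 \<le> ddiff f S"
      using xs divided_diff_eq_ddiff by simp
  qed
next
  assume "\<forall>S. finite S \<and> card S = p + 2 \<and> S \<subseteq> I \<longrightarrow> 0 \<le> ddiff f S"
  then show "p_convex_on (int p) I f"
    unfolding p_convex_on_def by (auto simp: divided_diff_eq_ddiff distinct_card)
qed

text \<open>A polynomial of degree \<open>j\<close> has vanishing divided differences at more than \<open>j + 1\<close> points.
  The induction on \<open>j\<close> splits off the last factor of the binomial as
  \<open>x - j = (x - a) + (a - j)\<close> with a point \<open>a\<close> of the set.\<close>

lemma ddiff_gchoose_eq_0:
  assumes "finite S" "j + 2 \<le> card S"
  shows "ddiff (\<lambda>x. x gchoose j) S = 0"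
proof -
  have up: "ddiff h S = 0"
    if low: "\<And>S. finite S \<Longrightarrow> card S = Suc k \<Longrightarrow> ddiff h S = 0"
      and S: "finite S" "card S = k + 2"
    for h k and S :: "real set"
  proof -
    obtain a b where ab: "a \<in> S" "b \<in> S" "a \<noteq> b"
      using S card_le_Suc0_iff_eq[of S] by auto
    have "(b - a) * ddiff h S = 0"
      using ddiff_recursion[of S a b h] low S ab by simp
    then show ?thesis
      using ab by simp
  qed
  have base: "ddiff (\<lambda>x. x gchoose j) S = 0" if "finite S" "card S = j + 2" for j and S :: "real set"
    using that
  proof (induction j arbitrary: S)
    case 0
    then obtain a b where "S = {a, b}" "a \<noteq> b"
      by (metis add_0 card_2_iff)
    moreover have "{a, b} - {a} = {b}" "{a, b} - {b} = {a}"
      using calculation by auto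
    ultimately show ?case
      by (simp add: ddiff_def field_simps)
  next
    case (Suc j)
    then obtain a where a: "a \<in> S"
      by fastforce
    \<comment> \<open>The term with \<open>x - a\<close> loses a point together with a degree; the other has one point more
      than is necessary.\<close>
    have eq: "(x gchoose Suc j) =
        inverse (real (Suc j)) * ((x - a) * (x gchoose j) + (a - real j) * (x gchoose j))" for x :: real
      using gbinomial_mult_1[of x j] by (simp add: field_simps)
    have "ddiff (\<lambda>x. x gchoose Suc j) S = inverse (real (Suc j)) *
        (ddiff (\<lambda>x. x gchoose j) (S - {a}) + (a - real j) * ddiff (\<lambda>x. x gchoose j) S)"
      unfolding eq ddiff_cmult ddiff_add using a Suc.prems by (simp add: ddiff_mult_node)
    moreover have "ddiff (\<lambda>x. x gchoose j) (S - {a}) = 0"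
      using Suc a by simp
    moreover have "ddiff (\<lambda>x. x gchoose j) S = 0"
      using up[of "Suc j"] Suc by simp
    ultimately show ?case
      by simp
  qed
  have "\<forall>S. finite S \<and> card S = i + (j + 2) \<longrightarrow> ddiff (\<lambda>x. x gchoose j) S = 0" for i
  proof (induction i)
    case (Suc i)
    then show ?case
      using up[of "i + j + 1"] by simp
  qed (use base in simp)
  then show ?thesis
    using assms le_Suc_ex[OF assms(2)] by (metis add.commute)
qed

lemma ddiff_const_eq_0: "finite S \<Longrightarrow> 2 \<le> card S \<Longrightarrow> ddiff (\<lambda>x. c) S = 0"
  using ddiff_gchoose_eq_0[of S 0] ddiff_cmult[of c "\<lambda>x. 1" S] by simp

section \<open>Monotonicity of divided differences of convex functions\<close>

text \<open>Convexity says that moving a single point to the right increases the divided difference at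
  one point fewer. To move all points of \<open>xs\<close> to those of \<open>ys\<close>, start with the largest, so
  that no point lands on one that has not moved yet. The set \<open>C\<close> collects the points to the left
  that are still waiting.\<close>

lemma ddiff_mono_list:
  assumes "p_convex_on (int p) I f" "card C + length xs = Suc p"
    and "list_all2 (\<le>) xs ys" "sorted_wrt (<) xs" "sorted_wrt (<) ys"
    and "finite C" "\<And>c x. c \<in> C \<Longrightarrow> x \<in> set xs \<Longrightarrow> c < x" "C \<union> set xs \<union> set ys \<subseteq> I"
  shows "ddiff f (C \<union> set xs) \<le> ddiff f (C \<union> set ys)"
  using assms(3,2,4-)
proof (induction arbitrary: C rule: list_all2_induct)
  case (Cons a xs b ys)
  have len: "length xs = length ys"
    using Cons.hyps list_all2_lengthD by blast
  have a: "a < y" if y: "y \<in> set ys" for y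
  proof -
    obtain i where i: "i < length ys" "y = ys ! i"
      using y by (metis in_set_conv_nth)
    then have "xs ! i \<le> ys ! i" "a < xs ! i"
      using Cons.hyps(2) Cons.prems(2) len by (simp_all add: list_all2_conv_all_nth)
    then show ?thesis
      using i by simp
  qed
  have notin: "a \<notin> C" "b \<notin> C" "a \<notin> set ys" "b \<notin> set ys"
    using Cons.prems(5)[of a a] Cons.prems(5)[of b a] Cons.hyps(1) Cons.prems(3) a[of a] a[of b]
    by auto
  have "C \<inter> set ys = {}"
    using Cons.prems(5)[of _ a] a by force
  moreover have "distinct ys"
    using Cons.prems strict_sorted_iff by auto
  ultimately have card: "card (C \<union> set ys) = p"
    using Cons.prems len by (simp add: card_Un_disjoint distinct_card)
  have "ddiff f (insert a C \<union> set xs) \<le> ddiff f (insert a C \<union> set ys)"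
    by (rule Cons.IH) (use Cons.prems notin in auto)
  also have "\<dots> \<le> ddiff f (insert b (C \<union> set ys))"
  proof (cases "a = b")
    case False
    have "0 \<le> ddiff f (insert a (insert b (C \<union> set ys)))"
      using assms(1) card Cons.prems notin False by (auto simp: p_convex_on_iff_ddiff)
    then have "0 \<le> (b - a) * ddiff f (insert a (insert b (C \<union> set ys)))"
      using Cons.hyps by simp
    then show ?thesis
      using ddiff_replace_node[of "C \<union> set ys" a b f] notin False Cons.prems by simp
  qed simp
  finally show ?case
    by simp
qed simp

lemma ddiff_mono_above:
  assumes "p_convex_on (int p) I f" "A \<subseteq> I" "B \<subseteq> I" "card A = Suc p" "card B = Suc p"
    and le: "\<And>a b. a \<in> A \<Longrightarrow> b \<in> B \<Longrightarrow> a \<le> b"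
  shows "ddiff f A \<le> ddiff f B"
proof -
  have fin: "finite A" "finite B"
    using assms by (auto intro: card_ge_0_finite)
  have "list_all2 (\<le>) (sorted_list_of_set A) (sorted_list_of_set B)"
    using fin assms by (auto simp: list_all2_conv_all_nth intro!: le)
      (metis fin length_sorted_list_of_set nth_mem set_sorted_list_of_set)+
  then show ?thesis
    using ddiff_mono_list[OF assms(1), of "{}" "sorted_list_of_set A" "sorted_list_of_set B"] fin assms
    by auto
qed

lemma p_convex_on_fdiff:
  assumes "p_convex_on (int (Suc p)) {M<..} f"
  shows "p_convex_on (int p) {M<..} (fdiff f)"
  unfolding p_convex_on_iff_ddiff
proof (intro allI impI)
  fix S :: "real set"
  assume S: "finite S \<and> card S = p + 2 \<and> S \<subseteq> {M<..}"
  let ?xs = "sorted_list_of_set S"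
  have "ddiff f ({} \<union> set ?xs) \<le> ddiff f ({} \<union> set (map (\<lambda>x. x + 1) ?xs))"
    using S by (intro ddiff_mono_list[OF assms])
      (auto simp: list_all2_conv_all_nth sorted_wrt_map less_imp_le)
  then have "ddiff f S \<le> ddiff (\<lambda>x. f (x + 1)) S"
    using S by (simp add: ddiff_shift)
  then show "0 \<le> ddiff (fdiff f) S"
    by (simp add: fdiff_def ddiff_diff)
qed

section \<open>The classes of eventually convex or concave functions\<close>

lemma funpow_fdiff_cong:
  assumes "\<And>x. x > 0 \<Longrightarrow> f x = g x" "x > 0"
  shows "(fdiff ^^ k) f x = (fdiff ^^ k) g x"
  using assms(2)
proof (induction k arbitrary: x)
  case (Suc k)
  from Suc.IH[of "x + 1"] Suc.IH[of x] Suc.prems show ?case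
    by (simp add: fdiff_def[of "(fdiff ^^ k) f"] fdiff_def[of "(fdiff ^^ k) g"])
qed (use assms in simp)

lemma D_class_cong:
  assumes "\<And>x. x > 0 \<Longrightarrow> f x = g x"
  shows "f \<in> D_class p \<longleftrightarrow> g \<in> D_class p"
proof -
  have "\<forall>\<^sub>F n in sequentially. (fdiff ^^ p) f (real n) = (fdiff ^^ p) g (real n)"
    using eventually_gt_at_top[of 0]
    by eventually_elim (rule funpow_fdiff_cong[OF assms], auto)
  then show ?thesis
    unfolding D_class_def mem_Collect_eq by (rule tendsto_cong)
qed

lemma K_class_cong:
  assumes "\<And>x. x > 0 \<Longrightarrow> f x = g x" "f \<in> K_class (int p)"
  shows "g \<in> K_class (int p)"
proof -
  obtain M where M: "M \<ge> 0" "p_convex_on (int p) {M<..} f \<or> p_concave_on (int p) {M<..} f"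
    using assms(2) by (auto simp: K_class_def)
  have "ddiff f S = ddiff g S" if "S \<subseteq> {M<..}" for S
  proof (rule ddiff_cong)
    fix x
    assume "x \<in> S"
    then have "M < x"
      using that by auto
    then show "f x = g x"
      using assms(1) M(1) by simp
  qed
  then have "p_convex_on (int p) {M<..} g \<or> p_concave_on (int p) {M<..} g"
    using M(2) unfolding p_concave_on_def p_convex_on_iff_ddiff ddiff_minus by metis
  then show ?thesis
    using M(1) by (auto simp: K_class_def)
qed

lemma K_class_uminus: "f \<in> K_class p \<Longrightarrow> (\<lambda>x. - f x) \<in> K_class p"
  by (auto simp: K_class_def p_concave_on_def)

lemma funpow_fdiff_uminus: "(fdiff ^^ k) (\<lambda>x. - f x) = (\<lambda>x. - (fdiff ^^ k) f x)"
  by (induction k) (auto simp: fdiff_def)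

lemma D_class_uminus: "f \<in> D_class p \<Longrightarrow> (\<lambda>x. - f x) \<in> D_class p"
  using tendsto_minus[of "\<lambda>n. (fdiff ^^ p) f (real n)" 0]
  by (simp add: D_class_def funpow_fdiff_uminus)

lemma K_class_fdiff:
  assumes "f \<in> K_class (int (Suc p))"
  shows "fdiff f \<in> K_class (int p)"
proof -
  obtain M where M: "M \<ge> 0" "p_convex_on (int (Suc p)) {M<..} f \<or> p_concave_on (int (Suc p)) {M<..} f"
    using assms by (auto simp: K_class_def)
  have "fdiff (\<lambda>x. - f x) = (\<lambda>x. - fdiff f x)"
    by (auto simp: fdiff_def)
  then have "p_convex_on (int p) {M<..} (fdiff f) \<or> p_concave_on (int p) {M<..} (fdiff f)"
    using M(2) p_convex_on_fdiff unfolding p_concave_on_def by metis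
  then show ?thesis
    using M(1) by (auto simp: K_class_def)
qed

text \<open>Either no divided difference of the lower order is positive, and the function is concave
  of that order, or one at some set \<open>A\<close> is, and by monotonicity so are all those at points to the
  right of \<open>A\<close>.\<close>

lemma p_convex_on_imp_K_class_lower:
  assumes "p_convex_on (int (Suc p)) {M<..} f" "M \<ge> 0"
  shows "f \<in> K_class (int p)"
proof (cases "\<exists>A. finite A \<and> card A = p + 2 \<and> A \<subseteq> {M<..} \<and> 0 < ddiff f A")
  case True
  then obtain A where A: "finite A" "card A = p + 2" "A \<subseteq> {M<..}" "0 < ddiff f A"
    by blast
  have M: "M < Max A"
    using A by (metis Max_in card.empty add_2_eq_Suc' greaterThan_iff nat.simps(3) subsetD)
  have "0 \<le> ddiff f S" if S: "finite S" "card S = p + 2" "S \<subseteq> {Max A<..}" for S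
  proof -
    have "ddiff f A \<le> ddiff f S"
    proof (rule ddiff_mono_above[OF assms(1)])
      show "a \<le> b" if "a \<in> A" "b \<in> S" for a b
        using Max_ge[OF A(1) that(1)] subsetD[OF S(3) that(2)] by simp
      show "S \<subseteq> {M<..}"
        using S(3) M by fastforce
    qed (use A(2,3) S(2) in simp_all)
    then show ?thesis
      using A by simp
  qed
  then have "p_convex_on (int p) {Max A<..} f"
    by (simp add: p_convex_on_iff_ddiff)
  then show ?thesis
    using M assms(2) by (auto simp: K_class_def intro!: exI[of _ "Max A"])
next
  case False
  then have "p_concave_on (int p) {M<..} f"
    unfolding p_concave_on_def p_convex_on_iff_ddiff by (auto simp: ddiff_minus not_less)
  then show ?thesis
    using assms(2) by (auto simp: K_class_def)
qed

lemma K_class_Suc_subset: "f \<in> K_class (int (Suc p)) \<Longrightarrow> f \<in> K_class (int p)"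
proof -
  assume "f \<in> K_class (int (Suc p))"
  then obtain M where M: "M \<ge> 0" "p_convex_on (int (Suc p)) {M<..} f \<or> p_concave_on (int (Suc p)) {M<..} f"
    by (auto simp: K_class_def)
  from M(2) show ?thesis
  proof
    assume "p_convex_on (int (Suc p)) {M<..} f"
    then show ?thesis
      using M p_convex_on_imp_K_class_lower by blast
  next
    assume "p_concave_on (int (Suc p)) {M<..} f"
    then have "(\<lambda>x. - f x) \<in> K_class (int p)"
      using M p_convex_on_imp_K_class_lower unfolding p_concave_on_def by blast
    then show ?thesis
      using K_class_uminus by fastforce
  qed
qed

lemma K_class_antimono:
  assumes "p \<le> q" "f \<in> K_class (int q)"
  shows "f \<in> K_class (int p)"
  using assms by (induction q rule: dec_induct) (blast intro: K_class_Suc_subset)+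

lemma K_class_funpow_fdiff: "f \<in> K_class (int (p + k)) \<Longrightarrow> (fdiff ^^ k) f \<in> K_class (int p)"
proof (induction k arbitrary: p)
  case (Suc k)
  have "(fdiff ^^ k) f \<in> K_class (int (Suc p))"
    by (rule Suc.IH) (use Suc.prems in simp)
  from K_class_fdiff[OF this] show ?case
    by simp
qed simp

lemma D_class_mono:
  assumes "p \<le> q" "f \<in> D_class p"
  shows "f \<in> D_class q"
  using assms
proof (induction q rule: dec_induct)
  case (step q)
  then have lim: "(\<lambda>n. (fdiff ^^ q) f (real n)) \<longlonglongrightarrow> 0"
    by (simp add: D_class_def)
  then have "(\<lambda>n. (fdiff ^^ q) f (real (Suc n))) \<longlonglongrightarrow> 0"
    by (rule LIMSEQ_Suc)
  from tendsto_diff[OF this lim] show ?case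
    by (simp add: D_class_def fdiff_def add.commute)
qed

section \<open>The remainder of Newton interpolation\<close>

text \<open>The points at which the Newton polynomial in \<open>rho a q f\<close> interpolates \<open>f\<close>.\<close>

definition nodes :: "real \<Rightarrow> nat \<Rightarrow> real set" where
  "nodes a q = (\<lambda>i. a + real i) ` {..<q}"

lemma nodes_Suc: "nodes a (Suc q) = insert (a + real q) (nodes a q)"
  by (simp add: nodes_def lessThan_Suc)

lemma nodes_Suc': "nodes a (Suc q) = insert a (nodes (a + 1) q)"
  by (auto simp: nodes_def lessThan_Suc_eq_insert_0 image_image add.assoc add.commute)

lemma finite_nodes [simp]: "finite (nodes a q)"
  by (simp add: nodes_def)

lemma card_nodes [simp]: "card (nodes a q) = q"
  by (simp add: nodes_def card_image inj_on_def)

lemma ddiff_nodes: "ddiff f (nodes a (Suc q)) = (fdiff ^^ q) f a / fact q"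
proof (induction q arbitrary: a)
  case 0
  then show ?case
    by (simp add: nodes_def ddiff_def lessThan_Suc)
next
  case (Suc q)
  let ?C = "nodes (a + 1) q"
  have "ddiff f (insert (a + real (Suc q)) ?C) - ddiff f (insert a ?C) =
      real (Suc q) * ddiff f (insert a (insert (a + real (Suc q)) ?C))"
    by (subst ddiff_replace_node) (auto simp: nodes_def)
  moreover have "insert (a + real (Suc q)) ?C = nodes (a + 1) (Suc q)"
    by (simp add: nodes_Suc add_ac)
  ultimately have "ddiff f (nodes (a + 1) (Suc q)) - ddiff f (nodes a (Suc q)) =
      real (Suc q) * ddiff f (nodes a (Suc (Suc q)))"
    by (simp only: nodes_Suc')
  then have "(fdiff ^^ q) f (a + 1) / fact q - (fdiff ^^ q) f a / fact q
      = real (Suc q) * ddiff f (nodes a (Suc (Suc q)))"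
    by (simp only: Suc.IH)
  then show ?case
    by (simp add: field_simps fdiff_def[of "(fdiff ^^ q) f"] del: of_nat_Suc)
qed

lemma rho_Suc: "rho a (Suc q) f x = rho a q f x - (x gchoose q) * (fdiff ^^ q) f a"
  by (simp add: rho_def)

text \<open>This is Newton's form of the interpolation error. Adding a node changes the divided difference
  by \<open>x - q\<close> times the next one, which supplies the next factor of the binomial.\<close>

lemma rho_eq_ddiff:
  assumes "\<And>i. i < q \<Longrightarrow> x \<noteq> real i"
  shows "rho a q f x = fact q * (x gchoose q) * ddiff f (insert (a + x) (nodes a q))"
  using assms
proof (induction q)
  case 0
  then show ?case
    by (simp add: nodes_def ddiff_def rho_def add.commute)
next
  case (Suc q)
  have x: "x \<noteq> real q" "a + x \<notin> nodes a q"
    using Suc.prems by (auto simp: nodes_def)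
  have "rho a (Suc q) f x = fact q * (x gchoose q) *
      (ddiff f (insert (a + x) (nodes a q)) - ddiff f (nodes a (Suc q)))"
    using Suc by (simp add: rho_Suc ddiff_nodes algebra_simps)
  also have "ddiff f (insert (a + x) (nodes a q)) - ddiff f (nodes a (Suc q)) =
      (x - real q) * ddiff f (insert (a + x) (nodes a (Suc q)))"
    unfolding nodes_Suc using x
    by (subst ddiff_replace_node) (auto simp: nodes_def insert_commute)
  also have "fact q * (x gchoose q) * ((x - real q) * ddiff f (insert (a + x) (nodes a (Suc q)))) =
      fact (Suc q) * (x gchoose Suc q) * ddiff f (insert (a + x) (nodes a (Suc q)))"
  proof -
    have "real (Suc q) * (x gchoose Suc q) = (x - real q) * (x gchoose q)"
      using gbinomial_mult_1[of x q] by (simp add: algebra_simps)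
    then have "fact (Suc q) * (x gchoose Suc q) = fact q * ((x - real q) * (x gchoose q))"
      by (simp only: fact_Suc mult_ac)
    then show ?thesis
      by (simp only: mult_ac)
  qed
  finally show ?case .
qed

text \<open>At the node \<open>q\<close> the error formula for the first \<open>q\<close> nodes still applies, and its
  divided difference is the very coefficient that the next Newton term subtracts.\<close>

lemma rho_at_node:
  assumes "i < q"
  shows "rho a q f (real i) = 0"
  using assms
proof (induction q)
  case (Suc q)
  show ?case
  proof (cases "i = q")
    case True
    have "rho a q f (real q) = fact q * (real q gchoose q) * ddiff f (nodes a (Suc q))"
      unfolding nodes_Suc by (rule rho_eq_ddiff) auto
    then show ?thesis
      using True by (simp add: rho_Suc ddiff_nodes flip: binomial_gbinomial)
  next
    case False
    then show ?thesis
      using Suc by (simp add: rho_Suc binomial_eq_0 flip: binomial_gbinomial)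
  qed
qed simp

text \<open>The error is a multiple of the difference \<open>u - v\<close> of two divided differences that share the
  \<open>p\<close> nodes \<open>a + 1, \<dots>, a + p\<close> and have \<open>a + 1 + x\<close> or \<open>a + p + 1\<close> as the remaining point. By
  monotonicity, both are at least the divided difference at the consecutive points starting from
  \<open>a\<close>, and at most the one at those starting from \<open>a + 1 + N\<close>, none of which lies to the
  left of any of these points.\<close>

lemma rho_bound:
  assumes "p_convex_on (int p) {M<..} f" "M < a" "0 < x" "x \<le> real N" "p \<le> N"
  shows "\<bar>rho (a + 1) (Suc p) f x\<bar> \<le>
    \<bar>x gchoose p\<bar> * ((fdiff ^^ p) f (a + 1 + real N) - (fdiff ^^ p) f a)"
proof (cases "\<exists>i<p. x = real i")
  case True
  then show ?thesis
    using rho_at_node[of _ "Suc p" "a + 1" f] 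
    by (auto simp: binomial_eq_0 simp flip: binomial_gbinomial)
next
  case False
  let ?C = "nodes (a + 1) p"
  have inC: "a + 1 + x \<notin> ?C" "a \<notin> ?C" 
    using False by (auto simp: nodes_def)
  define u where "u = ddiff f (insert (a + 1 + x) ?C)"
  define v where "v = ddiff f (nodes (a + 1) (Suc p))"
  have sub: "nodes b k \<subseteq> {M<..}" if "M < b" for b k
    using that by (auto simp: nodes_def)
  have lower: "ddiff f (insert a ?C) \<le> ddiff f (insert (a + y) ?C)"
    if "0 < y" "a + y \<notin> ?C" for y
  proof -
    have "0 \<le> ddiff f (insert a (insert (a + y) ?C))"
      using assms(1,2) that inC sub[of "a + 1" p] by (auto simp: p_convex_on_iff_ddiff)
    then have "0 \<le> y * ddiff f (insert a (insert (a + y) ?C))"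
      using that by simp
    then show ?thesis
      using ddiff_replace_node[of ?C a "a + y" f] that inC by simp
  qed
  have lu: "ddiff f (nodes a (Suc p)) \<le> u"
    using lower[of "1 + x"] inC assms by (simp add: u_def nodes_Suc' add.assoc)
  have lv: "ddiff f (nodes a (Suc p)) \<le> v"
  proof -
    have "a + (1 + real p) \<notin> ?C"
      by (auto simp: nodes_def)
    from lower[OF _ this] show ?thesis
      by (simp add: v_def nodes_Suc'[of a] nodes_Suc[of "a + 1"] add.assoc)
  qed
  have upper: "ddiff f B \<le> ddiff f (nodes (a + 1 + real N) (Suc p))"
    if "card B = Suc p" "B \<subseteq> {M<..a + 1 + real N}" for B
  proof (rule ddiff_mono_above[OF assms(1)])
    show "b \<le> c" if "b \<in> B" "c \<in> nodes (a + 1 + real N) (Suc p)" for b c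
    proof -
      have "b \<le> a + 1 + real N"
        using \<open>B \<subseteq> _\<close> that(1) by auto
      also have "\<dots> \<le> c"
        using that(2) by (auto simp: nodes_def)
      finally show ?thesis .
    qed
    show "B \<subseteq> {M<..}"
      using that(2) by auto
  qed (use that(1) sub[of "a + 1 + real N" "Suc p"] assms(2) in simp_all)
  have CM: "?C \<subseteq> {M<..a + 1 + real N}" "nodes (a + 1) (Suc p) \<subseteq> {M<..a + 1 + real N}"
    using assms by (auto simp: nodes_def)
  have uu: "u \<le> ddiff f (nodes (a + 1 + real N) (Suc p))"
    unfolding u_def by (rule upper) (use inC CM assms in simp_all)
  have uv: "v \<le> ddiff f (nodes (a + 1 + real N) (Suc p))"
    unfolding v_def by (rule upper) (use CM in simp_all)
  have "rho (a + 1) (Suc p) f x = (x gchoose p) * (fact p * (u - v))"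
    using False rho_eq_ddiff[of p x "a + 1" f]
    by (auto simp: rho_Suc u_def v_def ddiff_nodes algebra_simps)
  also have "\<bar>\<dots>\<bar> = \<bar>x gchoose p\<bar> * (fact p * \<bar>u - v\<bar>)"
    by (simp add: abs_mult)
  also have "\<dots> \<le> \<bar>x gchoose p\<bar> *
      (fact p * (ddiff f (nodes (a + 1 + real N) (Suc p)) - ddiff f (nodes a (Suc p))))"
    using lu lv uu uv by (intro mult_left_mono) auto
  also have "\<dots> = \<bar>x gchoose p\<bar> * ((fdiff ^^ p) f (a + 1 + real N) - (fdiff ^^ p) f a)"
    by (simp add: ddiff_nodes right_diff_distrib)
  finally show ?thesis .
qed

section \<open>Vanishing of the remainder and uniqueness\<close>

lemma rho_uminus: "rho a q (\<lambda>x. - f x) x = - rho a q f x"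
  by (simp add: rho_def funpow_fdiff_uminus sum_negf)

lemma rho_diff: "rho a q (\<lambda>x. f x - g x) x = rho a q f x - rho a q g x"
proof -
  have "(fdiff ^^ j) (\<lambda>x. f x - g x) = (\<lambda>x. (fdiff ^^ j) f x - (fdiff ^^ j) g x)" for j
    by (induction j) (auto simp: fdiff_def)
  then show ?thesis
    by (simp add: rho_def sum_subtractf right_diff_distrib)
qed

lemma rho_bound_sequence:
  assumes "p_convex_on (int p) {M<..} f" "0 < x"
  obtains N where "\<And>n. M < real n \<Longrightarrow> \<bar>rho (real (Suc n)) (Suc p) f x\<bar> \<le>
    \<bar>x gchoose p\<bar> * ((fdiff ^^ p) f (real (n + N)) - (fdiff ^^ p) f (real n))"
proof -
  obtain k where k: "x \<le> real k"
    using real_arch_simple by blast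
  have "\<bar>rho (real (Suc n)) (Suc p) f x\<bar> \<le>
      \<bar>x gchoose p\<bar> * ((fdiff ^^ p) f (real (n + Suc (max k p))) - (fdiff ^^ p) f (real n))"
    if "M < real n" for n
    using rho_bound[of p M f "real n" x "max k p"] assms k that by (simp add: add_ac)
  then show ?thesis
    by (rule that)
qed

lemma tendsto_shift_diff:
  fixes L :: "nat \<Rightarrow> real"
  assumes "(\<lambda>n. L (Suc n) - L n) \<longlonglongrightarrow> 0"
  shows "(\<lambda>n. L (n + N) - L n) \<longlonglongrightarrow> 0"
proof (induction N)
  case (Suc N)
  have "(\<lambda>n. L (n + N + 1) - L (n + N)) \<longlonglongrightarrow> 0"
    using LIMSEQ_ignore_initial_segment[OF assms, of N] by simp
  from tendsto_add[OF this Suc.IH] show ?case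
    by simp
qed simp

lemma summable_shift_diff:
  fixes L :: "nat \<Rightarrow> real"
  assumes "L \<longlonglongrightarrow> 0"
  shows "summable (\<lambda>n. L (n + N) - L n)"
proof (induction N)
  case (Suc N)
  have "summable (\<lambda>n. L (Suc n + N) - L (n + N))"
    by (rule telescope_summable[of _ 0]) (rule LIMSEQ_ignore_initial_segment[OF assms])
  from summable_add[OF this Suc.IH] show ?case
    by simp
qed simp

lemma rho_tendsto_0:
  assumes "f \<in> K_class (int p)" "f \<in> D_class (Suc p)" "0 < x"
  shows "(\<lambda>n. rho (real n) (Suc p) f x) \<longlonglongrightarrow> 0"
proof -
  have convex_case: "(\<lambda>n. rho (real n) (Suc p) f x) \<longlonglongrightarrow> 0"
    if f: "p_convex_on (int p) {M<..} f" "f \<in> D_class (Suc p)" for M f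
  proof -
    let ?L = "\<lambda>n. (fdiff ^^ p) f (real n)"
    obtain N where N: "\<And>n. M < real n \<Longrightarrow> \<bar>rho (real (Suc n)) (Suc p) f x\<bar> \<le>
        \<bar>x gchoose p\<bar> * (?L (n + N) - ?L n)"
      using rho_bound_sequence[OF f(1) assms(3)] by blast
    have "(\<lambda>n. ?L (Suc n) - ?L n) \<longlonglongrightarrow> 0"
      using f(2) by (simp add: D_class_def fdiff_def add.commute)
    from tendsto_mult_right_zero[OF tendsto_shift_diff[OF this, of N], of "\<bar>x gchoose p\<bar>"]
    have "(\<lambda>n. \<bar>x gchoose p\<bar> * (?L (n + N) - ?L n)) \<longlonglongrightarrow> 0" .
    moreover have "norm (rho (real (Suc n)) (Suc p) f x) \<le>
        norm (\<bar>x gchoose p\<bar> * (?L (n + N) - ?L n)) * 1" if "M < real n" for n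
      using N[OF that] abs_ge_self[of "\<bar>x gchoose p\<bar> * (?L (n + N) - ?L n)"]
      unfolding real_norm_def mult_1_right by linarith
    then have "\<forall>\<^sub>F n in sequentially. norm (rho (real (Suc n)) (Suc p) f x) \<le>
        norm (\<bar>x gchoose p\<bar> * (?L (n + N) - ?L n)) * 1"
      using eventually_gt_at_top[of "nat \<lceil>M\<rceil>"] by (rule eventually_mono[rotated]) linarith
    ultimately have "(\<lambda>n. rho (real (Suc n)) (Suc p) f x) \<longlonglongrightarrow> 0"
      by (rule tendsto_0_le)
    then show ?thesis
      by (rule LIMSEQ_imp_Suc)
  qed
  obtain M where "p_convex_on (int p) {M<..} f \<or> p_concave_on (int p) {M<..} f"
    using assms(1) by (auto simp: K_class_def)
  then show ?thesis
  proof
    assume "p_concave_on (int p) {M<..} f"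
    then have "(\<lambda>n. - rho (real n) (Suc p) f x) \<longlonglongrightarrow> 0"
      using convex_case[OF _ D_class_uminus[OF assms(2)]] by (simp add: p_concave_on_def rho_uminus)
    from tendsto_minus[OF this] show ?thesis
      by simp
  qed (use convex_case assms(2) in blast)
qed

text \<open>The difference \<open>w\<close> of two solutions has period one and vanishes at the positive integers, so all Newton
  terms are zero and its interpolation error at \<open>x\<close> is \<open>w x\<close>, at whichever integer the nodes start. As a
  difference of errors of the two solutions, it also tends to zero.\<close>

lemma difference_equation_unique:
  assumes g: "g \<in> D_class p"
    and f: "f1 \<in> K_class (int p)" "f2 \<in> K_class (int p)"
    and eq: "\<And>x. 0 < x \<Longrightarrow> fdiff f1 x = g x" "\<And>x. 0 < x \<Longrightarrow> fdiff f2 x = g x"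
    and one: "f1 1 = f2 1" and "0 < x"
  shows "f1 x = f2 x"
proof -
  have D: "h \<in> D_class (Suc p)" if "\<And>x. 0 < x \<Longrightarrow> fdiff h x = g x" for h
  proof -
    have "fdiff h \<in> D_class p"
      using D_class_cong[of "fdiff h" g p] that g by blast
    then show ?thesis
      by (simp add: D_class_def funpow_Suc_right del: funpow.simps)
  qed
  define w where "w = (\<lambda>x. f1 x - f2 x)"
  have period: "w (y + real n) = w y" if "0 < y" for y n
  proof (induction n)
    case (Suc n)
    have "fdiff w (y + real n) = 0"
      using eq[of "y + real n"] that by (simp add: w_def fdiff_def algebra_simps)
    then show ?case
      using Suc by (simp add: fdiff_def add_ac)
  qed simp
  have zero: "(fdiff ^^ Suc j) w y = 0" if "0 < y" for j y
  proof -
    have fw: "fdiff w y = 0" if "0 < y" for y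
      using period[of y 1] that by (simp add: fdiff_def)
    have "(fdiff ^^ j) (fdiff w) y = (fdiff ^^ j) (\<lambda>y. 0) y"
      by (rule funpow_fdiff_cong) (use fw that in auto)
    moreover have "(fdiff ^^ j) (\<lambda>y. 0) = (\<lambda>y. 0)"
      by (induction j) (auto simp: fdiff_def)
    ultimately show ?thesis
      by (simp add: funpow_Suc_right del: funpow.simps)
  qed
  have rho_w: "rho (real (Suc n)) (Suc p) w x = w x" for n
  proof -
    have "w (x + real (Suc n)) = w x"
      using period[OF \<open>0 < x\<close>] .
    moreover have "w (real (Suc n)) = 0"
      using period[of 1 n] one by (simp add: w_def add.commute)
    moreover have "(\<Sum>j<p. (x gchoose Suc j) * (fdiff ^^ Suc j) w (real (Suc n))) = 0"
      by (rule sum.neutral) (use zero in auto)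
    ultimately show ?thesis
      unfolding rho_def sum.lessThan_Suc_shift by simp
  qed
  have "(\<lambda>n. rho (real n) (Suc p) w x) \<longlonglongrightarrow> 0"
    unfolding w_def rho_diff
    using tendsto_diff[OF rho_tendsto_0[OF f(1) D[OF eq(1)] \<open>0 < x\<close>]
        rho_tendsto_0[OF f(2) D[OF eq(2)] \<open>0 < x\<close>]] by simp
  from LIMSEQ_Suc[OF this] have "w x = 0"
    unfolding rho_w by (simp add: LIMSEQ_const_iff)
  then show ?thesis
    by (simp add: w_def)
qed

section \<open>Existence of the principal solution\<close>

text \<open>The \<open>n\<close>-th approximation to the solution, up to a constant that depends on \<open>n\<close>. The
  sequence itself need not converge; its difference from its value at \<open>1\<close> does, and this
  difference also has the prescribed initial value.\<close>

definition partial_solution :: "nat \<Rightarrow> (real \<Rightarrow> real) \<Rightarrow> nat \<Rightarrow> real \<Rightarrow> real" where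
  "partial_solution p g n x =
    (\<Sum>j<p. (x gchoose Suc j) * (fdiff ^^ j) g (real n)) - (\<Sum>k<n. g (x + real k))"

lemma partial_solution_Suc:
  "partial_solution p g (Suc n) x - partial_solution p g n x = - rho (real n) (Suc p) g x - g (real n)"
proof -
  have "(\<Sum>j<p. (x gchoose Suc j) * (fdiff ^^ j) g (real (Suc n))) -
      (\<Sum>j<p. (x gchoose Suc j) * (fdiff ^^ j) g (real n)) =
      (\<Sum>j<p. (x gchoose Suc j) * (fdiff ^^ Suc j) g (real n))"
    by (subst sum_subtractf[symmetric], rule sum.cong)
      (auto simp: fdiff_def[of "(fdiff ^^ _) g"] algebra_simps)
  moreover have "rho (real n) (Suc p) g x =
      g (x + real n) - g (real n) - (\<Sum>j<p. (x gchoose Suc j) * (fdiff ^^ Suc j) g (real n))"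
    unfolding rho_def sum.lessThan_Suc_shift by simp
  ultimately show ?thesis
    unfolding partial_solution_def sum.lessThan_Suc by linarith
qed

lemma fdiff_partial_solution:
  "partial_solution p g n (x + 1) - partial_solution p g n x = g x - rho (real n) p g x"
proof -
  have "(\<Sum>j<p. (x + 1 gchoose Suc j) * (fdiff ^^ j) g (real n)) -
      (\<Sum>j<p. (x gchoose Suc j) * (fdiff ^^ j) g (real n)) =
      (\<Sum>j<p. (x gchoose j) * (fdiff ^^ j) g (real n))"
    by (subst sum_subtractf[symmetric], rule sum.cong)
      (simp_all only: gbinomial_Suc_Suc distrib_right add_diff_cancel_right')
  moreover have "(\<Sum>k<n. g (x + 1 + real k)) - (\<Sum>k<n. g (x + real k)) = g (x + real n) - g x"
    by (induction n) (auto simp: algebra_simps)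
  ultimately show ?thesis
    unfolding partial_solution_def rho_def by simp
qed

lemma summable_rho:
  assumes g: "p_convex_on (int p) {M<..} g" "g \<in> D_class p" and "0 < x"
  shows "summable (\<lambda>n. rho (real n) (Suc p) g x)"
proof -
  let ?L = "\<lambda>n. (fdiff ^^ p) g (real n)"
  obtain N where N: "\<And>n. M < real n \<Longrightarrow> \<bar>rho (real (Suc n)) (Suc p) g x\<bar> \<le>
      \<bar>x gchoose p\<bar> * (?L (n + N) - ?L n)"
    using rho_bound_sequence[OF g(1) assms(3)] by blast
  have "?L \<longlonglongrightarrow> 0"
    using g(2) by (simp add: D_class_def)
  then have "summable (\<lambda>n. \<bar>x gchoose p\<bar> * (?L (n + N) - ?L n))"
    by (intro summable_mult summable_shift_diff)
  moreover have "\<forall>\<^sub>F n in sequentially.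
      norm (rho (real (Suc n)) (Suc p) g x) \<le> \<bar>x gchoose p\<bar> * (?L (n + N) - ?L n)"
    using eventually_gt_at_top[of "nat \<lceil>M\<rceil>"]
    by eventually_elim (unfold real_norm_def, rule N, linarith)
  ultimately have "summable (\<lambda>n. rho (real (Suc n)) (Suc p) g x)"
    by (rule summable_comparison_test_ev[rotated])
  then show ?thesis
    by (subst (asm) summable_Suc_iff)
qed

text \<open>The term \<open>g n\<close> of the increment does not depend on \<open>x\<close> and cancels against the one at
  \<open>1\<close>, which leaves only summable interpolation errors.\<close>

lemma convergent_partial_solution:
  assumes g: "p_convex_on (int p) {M<..} g" "g \<in> D_class p" and "0 < x"
  shows "convergent (\<lambda>n. partial_solution p g n x - partial_solution p g n 1)"
proof -
  define D where "D = (\<lambda>n. partial_solution p g n x - partial_solution p g n 1)"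
  have "summable (\<lambda>n. rho (real n) (Suc p) g 1 - rho (real n) (Suc p) g x)"
    by (rule summable_diff[OF summable_rho[OF g zero_less_one] summable_rho[OF g assms(3)]])
  moreover have "rho (real n) (Suc p) g 1 - rho (real n) (Suc p) g x = D (Suc n) - D n" for n
    using partial_solution_Suc[of p g n x] partial_solution_Suc[of p g n 1]
    unfolding D_def by linarith
  ultimately have "convergent (\<lambda>n. \<Sum>k<n. D (Suc k) - D k)"
    by (simp add: summable_iff_convergent)
  then have "convergent (\<lambda>n. D n - D 0)"
    by (simp add: sum_lessThan_telescope)
  from convergent_add[OF this convergent_const[of "D 0"]] show ?thesis
    by (simp add: D_def)
qed

text \<open>The binomial terms have degree at most \<open>p\<close> and drop out; what is left is a sum of translates
  of \<open>- g\<close>.\<close>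

lemma ddiff_partial_solution_le_0:
  assumes g: "p_convex_on (int p) {M<..} g"
    and S: "finite S" "card S = p + 2" "S \<subseteq> {M<..}"
  shows "ddiff (partial_solution p g n) S \<le> 0"
proof -
  have "ddiff (\<lambda>x. (x gchoose Suc j) * c) S = 0" if "j < p" for j c
    using ddiff_cmult[of c "\<lambda>x. x gchoose Suc j" S] ddiff_gchoose_eq_0[of S "Suc j"] S that
    by (simp add: mult.commute)
  moreover have "0 \<le> ddiff (\<lambda>x. g (x + real k)) S" for k
  proof -
    have "(\<lambda>x. x + real k) ` S \<subseteq> {M<..}"
      using S(3) by force
    moreover have "card ((\<lambda>x. x + real k) ` S) = p + 2"
      using S by (subst card_image) auto
    ultimately show ?thesis
      using g S(1) unfolding ddiff_shift p_convex_on_iff_ddiff by blast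
  qed
  ultimately show ?thesis
    unfolding partial_solution_def ddiff_diff ddiff_sum by (simp add: sum_nonneg)
qed

lemma p_convex_solution_exists:
  assumes g: "p_convex_on (int p) {M<..} g" "g \<in> D_class p" and "0 \<le> M"
  obtains f where "p_concave_on (int p) {M<..} f" "\<And>x. 0 < x \<Longrightarrow> fdiff f x = g x" "f 1 = 0"
proof -
  define D where "D = (\<lambda>n x. partial_solution p g n x - partial_solution p g n 1)"
  define f where "f = (\<lambda>x. lim (\<lambda>n. D n x))"
  have lim: "(\<lambda>n. D n x) \<longlonglongrightarrow> f x" if "0 < x" for x
    using convergent_partial_solution[OF g that] by (simp add: D_def f_def convergent_LIMSEQ_iff)
  have one: "f 1 = 0"
    by (simp add: f_def D_def)
  have eq: "fdiff f x = g x" if x: "0 < x" for x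
  proof -
    \<comment> \<open>The approximation fails the equation by the error with \<open>p\<close> nodes, which exceeds the error with
      \<open>p + 1\<close> nodes by a Newton term that vanishes in the limit as \<open>\<Delta>\<^sup>p g (n)\<close> does.\<close>
    have gK: "g \<in> K_class (int p)"
      using g(1) assms(3) by (auto simp: K_class_def)
    have "(\<lambda>n. rho (real n) (Suc p) g x) \<longlonglongrightarrow> 0"
      by (rule rho_tendsto_0[OF gK D_class_mono[OF _ g(2)] x]) simp
    moreover have "(\<lambda>n. (x gchoose p) * (fdiff ^^ p) g (real n)) \<longlonglongrightarrow> 0"
      using g(2) by (intro tendsto_mult_right_zero) (simp add: D_class_def)
    ultimately have "(\<lambda>n. rho (real n) (Suc p) g x + (x gchoose p) * (fdiff ^^ p) g (real n)) \<longlonglongrightarrow> 0 + 0"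
      by (rule tendsto_add)
    then have "(\<lambda>n. rho (real n) p g x) \<longlonglongrightarrow> 0"
      by (simp add: rho_Suc)
    from tendsto_diff[OF tendsto_const[of "g x"] this]
    have "(\<lambda>n. D n (x + 1) - D n x) \<longlonglongrightarrow> g x"
      by (simp add: D_def fdiff_partial_solution)
    moreover have "(\<lambda>n. D n (x + 1) - D n x) \<longlonglongrightarrow> f (x + 1) - f x"
      using x by (intro tendsto_diff lim) auto
    ultimately show ?thesis
      unfolding fdiff_def using LIMSEQ_unique by blast
  qed
  have "p_concave_on (int p) {M<..} f"
    unfolding p_concave_on_def p_convex_on_iff_ddiff ddiff_minus
  proof (intro allI impI)
    fix S :: "real set"
    assume S: "finite S \<and> card S = p + 2 \<and> S \<subseteq> {M<..}"
    have "(\<lambda>n. ddiff (D n) S) \<longlonglongrightarrow> ddiff f S"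
      unfolding ddiff_def divide_inverse
      using S assms(3) by (intro tendsto_sum tendsto_mult tendsto_const lim) force
    moreover have "ddiff (D n) S \<le> 0" for n
      using ddiff_partial_solution_le_0[OF g(1), of S n] S
      by (simp add: D_def ddiff_diff ddiff_const_eq_0)
    ultimately show "0 \<le> - ddiff f S"
      using LIMSEQ_le_const2 by fastforce
  qed
  then show ?thesis
    using eq one by (rule that)
qed

lemma difference_equation_solvable:
  assumes "g \<in> D_class p" "g \<in> K_class (int p)"
  obtains f where "f \<in> K_class (int p)" "\<And>x. 0 < x \<Longrightarrow> fdiff f x = g x" "f 1 = 0"
proof -
  obtain M where M: "M \<ge> 0" "p_convex_on (int p) {M<..} g \<or> p_concave_on (int p) {M<..} g"
    using assms(2) by (auto simp: K_class_def)
  from M(2) show ?thesis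
  proof
    assume "p_convex_on (int p) {M<..} g"
    then obtain f where "p_concave_on (int p) {M<..} f" "\<And>x. 0 < x \<Longrightarrow> fdiff f x = g x" "f 1 = 0"
      using p_convex_solution_exists assms(1) M(1) by blast
    then show ?thesis
      using that[of f] M(1) by (auto simp: K_class_def)
  next
    assume "p_concave_on (int p) {M<..} g"
    then obtain f where f: "p_concave_on (int p) {M<..} f" "\<And>x. 0 < x \<Longrightarrow> fdiff f x = - g x" "f 1 = 0"
      using p_convex_solution_exists[of p M "\<lambda>x. - g x"] D_class_uminus[OF assms(1)] M(1)
      unfolding p_concave_on_def by blast
    have "(\<lambda>x. - f x) \<in> K_class (int p)"
      using f(1) M(1) by (auto simp: K_class_def p_concave_on_def)
    moreover have "fdiff (\<lambda>x. - f x) x = g x" if "0 < x" for x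
      using f(2)[OF that] by (simp add: fdiff_def)
    ultimately show ?thesis
      using f(3) by (intro that[of "\<lambda>x. - f x"]) auto
  qed
qed

section \<open>The operator of indefinite summation\<close>

lemma fdiff_restrict: "0 < x \<Longrightarrow> fdiff (restrict f {0<..}) x = fdiff f x"
  by (simp add: fdiff_def)

text \<open>The competing solutions in the definition of \<open>\<Sigma>\<close> may belong to different orders. As the classes
  of convex functions shrink with the order, uniqueness applies at the smaller of the two.\<close>

lemma Sum_op_eqI:
  assumes g: "g \<in> D_class p" "g \<in> K_class (int p)"
    and f: "f \<in> K_class (int p)" "\<And>x. 0 < x \<Longrightarrow> fdiff f x = g x" "f 1 = 0"
    and "0 < x"
  shows "Sum_op g x = f x"
proof -
  have "Sum_op g = restrict f {0<..}"
    unfolding Sum_op_def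
  proof (rule the_equality)
    have "restrict f {0<..} \<in> K_class (int p)"
      by (rule K_class_cong[OF _ f(1)]) simp
    then show "restrict f {0<..} \<in> extensional {0<..} \<and>
        (\<exists>p. g \<in> D_class p \<inter> K_class (int p) \<and> restrict f {0<..} \<in> K_class (int p)) \<and>
        (\<forall>x>0. fdiff (restrict f {0<..}) x = g x) \<and> restrict f {0<..} 1 = 0"
      using g f by (auto simp: fdiff_restrict)
  next
    fix h
    assume h: "h \<in> extensional {0<..} \<and>
        (\<exists>p. g \<in> D_class p \<inter> K_class (int p) \<and> h \<in> K_class (int p)) \<and>
        (\<forall>x>0. fdiff h x = g x) \<and> h 1 = 0"
    then obtain q where q: "g \<in> D_class q" "h \<in> K_class (int q)"
      by blast
    have "h y = f y" if "0 < y" for y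
    proof (rule difference_equation_unique[where p = "min p q" and g = g and ?f1.0 = h and ?f2.0 = f])
      show "g \<in> D_class (min p q)"
        using g(1) q(1) by (simp add: min_def)
      show "h \<in> K_class (int (min p q))" "f \<in> K_class (int (min p q))"
        by (rule K_class_antimono[OF _ q(2)], simp) (rule K_class_antimono[OF _ f(1)], simp)
      show "fdiff h z = g z" "fdiff f z = g z" if "0 < z" for z
        using h f(2) that by blast+
      show "h 1 = f 1"
        using h f(3) by simp
    qed (rule that)
    then show "h = restrict f {0<..}"
      using h by (intro extensionalityI[of _ "{0<..}"]) auto
  qed
  then show ?thesis
    using \<open>0 < x\<close> by simp
qed

lemma fdiff_Sum_op:
  assumes "g \<in> dom_Sum" "0 < x"
  shows "fdiff (Sum_op g) x = g x"
proof -
  obtain p where g: "g \<in> D_class p" "g \<in> K_class (int p)"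
    using assms(1) by (auto simp: dom_Sum_def)
  from difference_equation_solvable[OF g] obtain f
    where f: "f \<in> K_class (int p)" "\<And>x. 0 < x \<Longrightarrow> fdiff f x = g x" "f 1 = 0"
    by blast
  have "Sum_op g y = f y" if "0 < y" for y
    using Sum_op_eqI[OF g f that] .
  then show ?thesis
    using f(2)[OF assms(2)] assms(2) by (simp add: fdiff_def)
qed

lemma funpow_fdiff_Sum_op:
  assumes "f \<in> dom_Sum_iter k" "0 < x"
  shows "(fdiff ^^ k) ((Sum_op ^^ k) f) x = f x"
  using assms
proof (induction k arbitrary: x)
  case (Suc k)
  let ?g = "(Sum_op ^^ k) f"
  have "fdiff (Sum_op ?g) y = ?g y" if "0 < y" for y
    by (rule fdiff_Sum_op) (use Suc.prems that in simp_all)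
  then have "(fdiff ^^ k) (fdiff (Sum_op ?g)) x = (fdiff ^^ k) ?g x"
    by (rule funpow_fdiff_cong) (use Suc.prems in simp_all)
  also have "\<dots> = f x"
    by (rule Suc.IH) (use Suc.prems in simp_all)
  finally show ?case
    by (subst funpow_Suc_right[of k fdiff]) simp
qed simp

section \<open>Commutation of iterated summation with an operator\<close>

lemma funpow_fdiff_rho:
  assumes "k \<le> q"
  shows "(fdiff ^^ k) (\<lambda>x. rho 1 q f (x - 1)) = (\<lambda>x. rho 1 (q - k) ((fdiff ^^ k) f) (x - 1))"
  using assms
proof (induction k)
  case (Suc k)
  have step: "fdiff (\<lambda>x. rho 1 (Suc r) h (x - 1)) = (\<lambda>x. rho 1 r (fdiff h) (x - 1))" for r h
  proof
    fix x :: real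
    have "(x gchoose Suc j) - (x - 1 gchoose Suc j) = (x - 1 gchoose j)" for j
      using gbinomial_Suc_Suc[of "x - 1" j] by simp
    then have "(\<Sum>j<r. (x gchoose Suc j) * (fdiff ^^ Suc j) h 1) -
        (\<Sum>j<r. (x - 1 gchoose Suc j) * (fdiff ^^ Suc j) h 1) =
        (\<Sum>j<r. (x - 1 gchoose j) * (fdiff ^^ Suc j) h 1)"
      by (simp only: sum_subtractf[symmetric] left_diff_distrib[symmetric])
    then show "fdiff (\<lambda>x. rho 1 (Suc r) h (x - 1)) x = rho 1 r (fdiff h) (x - 1)"
      unfolding fdiff_def[of "\<lambda>x. rho 1 (Suc r) h (x - 1)"] rho_def sum.lessThan_Suc_shift
      by (simp add: funpow_swap1) (simp add: fdiff_def)
  qed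
  have "q - k = Suc (q - Suc k)"
    using Suc.prems by simp
  then show ?case
    using Suc step[of "q - Suc k" "(fdiff ^^ k) f"] by simp
qed simp

text \<open>The subtracted polynomial has degree less than \<open>k \<le> q + 1\<close>, hence does not affect divided
  differences at \<open>q + 2\<close> points.\<close>

lemma K_class_rho:
  assumes "f \<in> K_class (int q)" "k \<le> Suc q"
  shows "(\<lambda>x. rho 1 k f (x - 1)) \<in> K_class (int q)"
proof -
  have "ddiff (\<lambda>x. rho 1 k f (x - 1)) S = ddiff f S" if S: "finite S" "card S = q + 2" for S
  proof -
    have "ddiff (\<lambda>x. (x - 1 gchoose j) * c) S = 0" if "j < k" for j c
    proof -
      have "ddiff (\<lambda>x. x - 1 gchoose j) S = ddiff (\<lambda>x. x gchoose j) ((\<lambda>x. x + - 1) ` S)"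
        using ddiff_shift[of "\<lambda>x. x gchoose j" "-1" S] by simp
      also have "\<dots> = 0"
        by (rule ddiff_gchoose_eq_0) (use S that assms(2) in \<open>auto simp: card_image inj_on_def\<close>)
      finally show ?thesis
        using ddiff_cmult[of c "\<lambda>x. x - 1 gchoose j" S] by (simp add: mult.commute)
    qed
    then show ?thesis
      unfolding rho_def ddiff_diff ddiff_sum by simp
  qed
  then show ?thesis
    using assms(1) unfolding K_class_def p_concave_on_def p_convex_on_iff_ddiff ddiff_minus by simp
qed

theorem proposition6p4:
  fixes T :: "(real \<Rightarrow> real) \<Rightarrow> (real \<Rightarrow> real)"
    and m p :: nat
    and f :: "real \<Rightarrow> real"
  assumes "linear_operator T"
    and "\<And>g x. x > 0 \<Longrightarrow> T (fdiff g) x = fdiff (T g) x"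
    and "f \<in> dom_Sum_iter (m + 1)"
    and "T f \<in> D_class p \<inter> K_class (int (p + m))"
    and "T ((Sum_op ^^ (m + 1)) f) \<in> K_class (int (p + 2 * m))"
  shows "\<forall>x>0. (Sum_op ^^ (m + 1)) (T f) x = rho 1 (m + 1) (T ((Sum_op ^^ (m + 1)) f)) (x - 1)"
proof -
  define F where "F = (Sum_op ^^ (m + 1)) f"
  define H where "H = (\<lambda>x. rho 1 (m + 1) (T F) (x - 1))"
  have T_cong: "T h x = T h' x" if "\<And>x. 0 < x \<Longrightarrow> h x = h' x" "0 < x" for h h' x
    using assms(1) that unfolding linear_operator_def by blast
  have T_funpow: "T ((fdiff ^^ k) h) x = (fdiff ^^ k) (T h) x" if "0 < x" for k h x
    using that
  proof (induction k arbitrary: x)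
    case (Suc k)
    have "fdiff (T ((fdiff ^^ k) h)) x = fdiff ((fdiff ^^ k) (T h)) x"
      using Suc by (simp add: fdiff_def[of "T ((fdiff ^^ k) h)"] fdiff_def[of "(fdiff ^^ k) (T h)"])
    then show ?case
      using assms(2)[of x "(fdiff ^^ k) h"] Suc.prems by simp
  qed simp
  have top: "(fdiff ^^ (m + 1)) H x = T f x" if "0 < x" for x
  proof -
    have "(fdiff ^^ (m + 1)) H x = (fdiff ^^ (m + 1)) (T F) x"
      unfolding H_def by (subst funpow_fdiff_rho) (simp_all add: rho_def)
    also have "\<dots> = T ((fdiff ^^ (m + 1)) F) x"
      by (rule T_funpow[OF that, symmetric])
    also have "\<dots> = T f x"
      unfolding F_def by (rule T_cong[OF _ that]) (rule funpow_fdiff_Sum_op[OF assms(3)])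
    finally show ?thesis .
  qed
  \<comment> \<open>Lowering the order of \<open>H\<close> to \<open>p + m + i\<close> first leaves the same order for all \<open>i\<close>.\<close>
  have H_K: "(fdiff ^^ i) H \<in> K_class (int (p + m))" if "i \<le> m" for i
  proof -
    have "H \<in> K_class (int (p + 2 * m))"
      unfolding H_def using assms(5) by (intro K_class_rho) (auto simp: F_def)
    then have "H \<in> K_class (int (p + m + i))"
      using K_class_antimono[of "p + m + i" "p + 2 * m" H] that by simp
    then show ?thesis
      by (rule K_class_funpow_fdiff)
  qed
  have H_D: "(fdiff ^^ i) H \<in> D_class (p + m)" if "1 \<le> i" "i \<le> m + 1" for i
  proof -
    have "(fdiff ^^ (m + 1)) H \<in> D_class p"
      using D_class_cong[of "(fdiff ^^ (m + 1)) H" "T f" p] top assms(4) by blast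
    moreover have "(fdiff ^^ (p + (m + 1 - i))) ((fdiff ^^ i) H) = (fdiff ^^ p) ((fdiff ^^ (m + 1)) H)"
    proof -
      have "p + (m + 1 - i) + i = p + (m + 1)"
        using that by simp
      then show ?thesis
        by (metis comp_apply funpow_add)
    qed
    ultimately have "(fdiff ^^ i) H \<in> D_class (p + (m + 1 - i))"
      unfolding D_class_def by simp
    then show ?thesis
      using D_class_mono[of "p + (m + 1 - i)" "p + m"] that by simp
  qed
  have H_1: "(fdiff ^^ i) H 1 = 0" if "i \<le> m" for i
  proof -
    have "rho 1 (m + 1 - i) ((fdiff ^^ i) (T F)) (real 0) = 0"
      by (rule rho_at_node) (use that in simp)
    then show ?thesis
      unfolding H_def by (subst funpow_fdiff_rho) (use that in simp_all)
  qed
  have "(Sum_op ^^ k) (T f) x = (fdiff ^^ (m + 1 - k)) H x" if "k \<le> m + 1" "0 < x" for k x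
    using that
  proof (induction k arbitrary: x)
    case 0
    then show ?case
      using top by simp
  next
    case (Suc k)
    let ?g = "(Sum_op ^^ k) (T f)"
    have g: "?g y = (fdiff ^^ (m + 1 - k)) H y" if "0 < y" for y
      using Suc that by simp
    have gD: "?g \<in> D_class (p + m)"
      using D_class_cong[of ?g "(fdiff ^^ (m + 1 - k)) H" "p + m"] g H_D[of "m + 1 - k"] Suc.prems(1)
      by simp
    have gK: "?g \<in> K_class (int (p + m))"
    proof (cases k)
      \<comment> \<open>\<open>T f\<close> itself is \<open>\<Delta>\<^sup>m\<^sup>+\<^sup>1 H\<close>, one difference too many for \<open>H_K\<close>.\<close>
      case 0
      then show ?thesis
        using assms(4) by simp
    next
      case Suc
      then show ?thesis
        using K_class_cong[OF g[symmetric] H_K] by simp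
    qed
    have eq: "fdiff ((fdiff ^^ (m - k)) H) y = ?g y" if "0 < y" for y
      using g[OF that] Suc.prems by (simp add: Suc_diff_le)
    have "Sum_op ?g x = (fdiff ^^ (m - k)) H x"
      by (rule Sum_op_eqI[OF gD gK H_K eq H_1]) (use Suc.prems in simp_all)
    then show ?case
      by simp
  qed
  from this[of "m + 1"] show ?thesis
    by (simp add: H_def F_def)
qed

end
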